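(* Let $q=e^{2\pi i\tau}$ with $\Im\tau>0$, let $\eta(\tau)=q^{1/24}\prod_{j\ge1}(1-q^j)$ and $P(q)=1-24\sum_{j\ge1}\frac{jq^j}{1-q^j}$. Define $$z=\tfrac14\bigl(6P(q^{12})-3P(q^6)+2P(q^4)-P(q^2)\bigr)+2\eta(2\tau)\eta(4\tau)\eta(6\tau)\eta(12\tau),\qquad x=\frac{\eta(2\tau)\eta(4\tau)\eta(6\tau)\eta(12\tau)}{z}.$$ Then, for $q$ in a neighborhood of $0$, $$q\frac{dx}{dq}=z\,x\,\sqrt{(1+4x)(1-4x)(1-8x)},$$ where the square root is the branch equal to $1$ at $x=0$. *)

theory Defs
  imports "HOL-Analysis.Analysis"
begin

definition nome :: "complex \<Rightarrow> complex" where
  "nome \<tau> = exp (2 * of_real pi * \<i> * \<tau>)"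

text \<open>The factor \<open>q\<^bsup>1/24\<^esup>\<close> is read as \<open>exp (2\<pi>i\<tau>/24)\<close>, so \<open>\<eta>\<close> is a function of \<open>\<tau>\<close> rather
  than of \<open>q\<close>.  The infinite product and sum are shifted to start at index 0.\<close>

definition dedekind_eta :: "complex \<Rightarrow> complex" where
  "dedekind_eta \<tau> = exp (2 * of_real pi * \<i> * \<tau> / 24) * (\<Prod>j. 1 - nome \<tau> ^ Suc j)"

definition ramanujan_P :: "complex \<Rightarrow> complex" where
  "ramanujan_P q = 1 - 24 * (\<Sum>j. of_nat (Suc j) * q ^ Suc j / (1 - q ^ Suc j))"

definition eta_prod :: "complex \<Rightarrow> complex" where
  "eta_prod \<tau> = dedekind_eta (2 * \<tau>) * dedekind_eta (4 * \<tau>) * dedekind_eta (6 * \<tau>) *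
     dedekind_eta (12 * \<tau>)"

definition z_fun :: "complex \<Rightarrow> complex" where
  "z_fun \<tau> = (let q = nome \<tau> in
     1 / 4 * (6 * ramanujan_P (q ^ 12) - 3 * ramanujan_P (q ^ 6) + 2 * ramanujan_P (q ^ 4)
       - ramanujan_P (q ^ 2)) + 2 * eta_prod \<tau>)"

definition x_fun :: "complex \<Rightarrow> complex" where
  "x_fun \<tau> = eta_prod \<tau> / z_fun \<tau>"

end

theory Submission
  imports Defs "HOL-Complex_Analysis.Complex_Analysis"
begin

text \<open>
  Put \<open>Q = q\<^sup>2\<close>, \<open>D = Q d/dQ\<close>, \<open>f = \<eta>(2\<tau>)\<eta>(4\<tau>)\<eta>(6\<tau>)\<eta>(12\<tau>)\<close> and \<open>E = z - 2f\<close>, and let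
  \<open>a, b, c, d\<close> be the eta quotients of weight 1 and level 6 (in the variable \<open>Q\<close>) vanishing only
  at the cusp \<open>0, 1/2, 1/3, \<infinity>\<close> respectively; then \<open>a b c d = f\<^sup>2\<close>.

  The classical identity that writes \<open>\<wp>(x) - \<wp>(y)\<close> as a quotient of theta functions, for the
  nome \<open>Q\<^sup>6\<close> and \<open>x, y \<in> {Q, Q\<^sup>2, Q\<^sup>3}\<close>, gives \<open>c d\<close>, \<open>b d\<close> and \<open>d\<^sup>2\<close> as combinations of the
  Lambert series in \<open>Q, Q\<^sup>2, Q\<^sup>3, Q\<^sup>6\<close>, and in particular \<open>c = b - d\<close>.  Logarithmic derivatives of
  eta quotients are such combinations as well, so that \<open>D log (b/c) = d (b - 9d)\<close> and
  \<open>D log (b/a) = 9 c d\<close>.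
  Differentiating \<open>c = b - d\<close> then yields \<open>D log (d/c) = b (b - 9d)\<close>, hence
  \<open>D log (b - 9d) = D log a\<close> and \<open>a = b - 9d\<close>.

  Now \<open>E = D log (b/a) + D log (d/c) = b\<^sup>2 - 9d\<^sup>2\<close>.  With \<open>S = b\<^sup>2 - 2bd + 9d\<^sup>2\<close> and
  \<open>T = b\<^sup>2 - 18bd + 9d\<^sup>2\<close> one has \<open>E\<^sup>2 - 4f\<^sup>2 = S\<^sup>2\<close>, \<open>E\<^sup>2 - 36f\<^sup>2 = T\<^sup>2\<close> and
  \<open>2 D E = E D log f\<^sup>2 - S T\<close>, which is the claim with \<open>S T/z\<^sup>2\<close> as the square root.
\<close>

section \<open>Infinite products and removable singularities\<close>

lemma convergent_prod_M_test:
  fixes f :: "nat \<Rightarrow> 'a :: {real_normed_div_algebra, banach, comm_ring_1}"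
  assumes "summable M" and "\<And>k. norm (f k - 1) \<le> M k"
  shows "convergent_prod f"
proof (intro abs_convergent_prod_imp_convergent_prod summable_imp_abs_convergent_prod)
  show "summable (\<lambda>k. norm (f k - 1))"
    by (rule summable_comparison_test'[OF assms(1)]) (use assms(2) in auto)
qed

lemma uniform_limit_prodinf_M_test:
  fixes f :: "nat \<Rightarrow> 'a :: topological_space \<Rightarrow> complex"
  assumes "compact K" and cont: "\<And>k. continuous_on K (f k)"
    and M: "summable M" and bound: "\<And>k x. x \<in> K \<Longrightarrow> norm (f k x - 1) \<le> M k"
  shows "uniform_limit K (\<lambda>n x. \<Prod>k<n. f k x) (\<lambda>x. \<Prod>k. f k x) sequentially"
proof -
  have "uniformly_convergent_on K (\<lambda>n x. \<Prod>k<n. f k x)"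
  proof (rule uniformly_convergent_on_prod'[OF cont \<open>compact K\<close>])
    show "uniformly_convergent_on K (\<lambda>N x. \<Sum>n<N. norm (f n x - 1))"
      by (rule Weierstrass_m_test'[OF _ M]) (use bound in auto)
  qed
  then obtain l where l: "uniform_limit K (\<lambda>n x. \<Prod>k<n. f k x) l sequentially"
    by (auto simp: uniformly_convergent_on_def)
  have "l x = (\<Prod>k. f k x)" if "x \<in> K" for x
  proof -
    have "(\<lambda>n. \<Prod>k<n. f k x) \<longlonglongrightarrow> (\<Prod>k. f k x)"
      using convergent_prod_LIMSEQ[OF convergent_prod_M_test[OF M bound[OF that]]]
      by (simp add: LIMSEQ_lessThan_iff_atMost)
    with tendsto_uniform_limitI[OF l that] show ?thesis by (rule LIMSEQ_unique)
  qed
  with l show ?thesis by (simp cong: uniform_limit_cong')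
qed

lemma
  fixes f :: "nat \<Rightarrow> complex \<Rightarrow> complex"
  assumes A: "open A" and holo: "\<And>k. f k holomorphic_on A"
    and M: "summable M" and bound: "\<And>k x. x \<in> A \<Longrightarrow> norm (f k x - 1) \<le> M k"
  shows holomorphic_on_prodinf: "(\<lambda>x. \<Prod>k. f k x) holomorphic_on A"
    and logderiv_prodinf_sums:
      "\<lbrakk>x \<in> A; \<And>k. f k x \<noteq> 0\<rbrakk> \<Longrightarrow>
        (\<lambda>k. deriv (f k) x / f k x) sums (deriv (\<lambda>x. \<Prod>k. f k x) x / (\<Prod>k. f k x))"
proof -
  have lim: "uniform_limit K (\<lambda>n x. \<Prod>k<n. f k x) (\<lambda>x. \<Prod>k. f k x) sequentially"
    if "compact K" "K \<subseteq> A" for K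
  proof (rule uniform_limit_prodinf_M_test[OF that(1) _ M])
    show "continuous_on K (f k)" for k
      using holo that(2) by (meson continuous_on_subset holomorphic_on_imp_continuous_on)
  qed (use bound that(2) in auto)
  show "(\<lambda>x. \<Prod>k. f k x) holomorphic_on A"
  proof (rule holomorphic_uniform_sequence[OF A])
    show "(\<lambda>x. \<Prod>k<n. f k x) holomorphic_on A" for n
      by (intro holomorphic_intros holo)
    show "\<exists>d>0. cball x d \<subseteq> A \<and>
        uniform_limit (cball x d) (\<lambda>n x. \<Prod>k<n. f k x) (\<lambda>x. \<Prod>k. f k x) sequentially"
      if "x \<in> A" for x
      using A that lim[OF compact_cball] by (meson open_contains_cball)
  qed
  assume x: "x \<in> A" and nz: "\<And>k. f k x \<noteq> 0"
  from A x obtain d where d: "d > 0" "cball x d \<subseteq> A"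
    by (meson open_contains_cball)
  show "(\<lambda>k. deriv (f k) x / f k x) sums (deriv (\<lambda>x. \<Prod>k. f k x) x / (\<Prod>k. f k x))"
  proof (rule logderiv_prodinf_complex_uniform_limit)
    show "uniform_limit (ball x d) (\<lambda>n x. \<Prod>k<n. f k x) (\<lambda>x. \<Prod>k. f k x) sequentially"
      using lim[OF compact_cball d(2)] by (rule uniform_limit_on_subset) auto
    show "f k holomorphic_on ball x d" for k
      using holo d(2) by (meson ball_subset_cball holomorphic_on_subset)
    show "(\<Prod>k. f k x) \<noteq> 0"
      by (rule prodinf_nonzero[OF convergent_prod_M_test[OF M bound[OF x]] nz])
  qed (use d in auto)
qed

lemma removable_double_zero:
  fixes f :: "complex \<Rightarrow> complex"
  assumes S: "open S" and f: "f holomorphic_on S" and "f a = 0" "deriv f a = 0"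
  obtains g where "g holomorphic_on S" "\<And>z. z \<noteq> a \<Longrightarrow> g z = f z / (z - a)\<^sup>2"
proof -
  define slope where "slope = (\<lambda>z. if z = a then deriv f a else (f z - f a) / (z - a))"
  have slope: "slope holomorphic_on S"
    unfolding slope_def by (rule pole_lemma_open[OF f S])
  have "(\<lambda>z. if z = a then deriv slope a else (slope z - slope a) / (z - a)) holomorphic_on S"
    by (rule pole_lemma_open[OF slope S])
  then show ?thesis
    by (rule that) (use assms in \<open>auto simp: slope_def power2_eq_square\<close>)
qed

section \<open>The theta function and the Weierstrass function in multiplicative form\<close>

definition qpoch :: "complex \<Rightarrow> complex \<Rightarrow> complex" where
  "qpoch x p = (\<Prod>j. 1 - x * p ^ j)"

definition euler :: "complex \<Rightarrow> complex" where
  "euler q = qpoch q q"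

definition theta :: "complex \<Rightarrow> complex \<Rightarrow> complex" where
  "theta x p = qpoch x p * qpoch (p / x) p"

definition koebe :: "complex \<Rightarrow> complex" where
  "koebe v = v / (1 - v)\<^sup>2"

definition koebe_sum :: "complex \<Rightarrow> complex \<Rightarrow> complex" where
  "koebe_sum x p = (\<Sum>j. koebe (x * p ^ j))"

text \<open>With \<open>x = e\<^bsup>u\<^esup>\<close> and \<open>p = e\<^bsup>2\<pi>i\<tau>\<^esup>\<close> this is \<open>\<wp>(u)\<close> for the lattice \<open>2\<pi>i(\<int> + \<tau>\<int>)\<close>, up to an
  additive constant.\<close>

definition wp :: "complex \<Rightarrow> complex \<Rightarrow> complex" where
  "wp x p = koebe_sum x p + koebe_sum (p / x) p"

lemma summable_mult_power:
  fixes r :: real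
  assumes "0 \<le> r" "r < 1"
  shows "summable (\<lambda>k. c * r ^ k)"
  using assms by (intro summable_mult summable_geometric) simp

lemma convergent_prod_qpoch:
  fixes x p :: complex
  assumes "norm p < 1"
  shows "convergent_prod (\<lambda>j. 1 - x * p ^ j)"
proof (rule convergent_prod_M_test)
  show "summable (\<lambda>k. norm x * norm p ^ k)"
    by (rule summable_mult_power) (use assms in auto)
qed (simp add: norm_mult norm_power)

lemma qpoch_LIMSEQ:
  assumes "norm p < 1"
  shows "(\<lambda>n. \<Prod>j<n. 1 - x * p ^ j) \<longlonglongrightarrow> qpoch x p"
  using convergent_prod_LIMSEQ[OF convergent_prod_qpoch[OF assms]]
  by (simp add: qpoch_def LIMSEQ_lessThan_iff_atMost)

lemma qpoch_holomorphic [holomorphic_intros]: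
  assumes p: "norm p < 1" and "f holomorphic_on S"
  shows "(\<lambda>w. qpoch (f w) p) holomorphic_on S"
proof -
  have "(\<lambda>x. qpoch x p) holomorphic_on ball 0 r" for r
    unfolding qpoch_def
  proof (rule holomorphic_on_prodinf)
    show "summable (\<lambda>k. r * norm p ^ k)"
      by (rule summable_mult_power) (use p in auto)
    show "norm (1 - x * p ^ k - 1) \<le> r * norm p ^ k" if "x \<in> ball 0 r" for x k
      using that by (auto simp: norm_mult norm_power intro!: mult_right_mono)
  qed (auto intro!: holomorphic_intros)
  then have "(\<lambda>x. qpoch x p) field_differentiable at x" for x
    by (rule holomorphic_on_imp_differentiable_at[of _ "ball 0 (norm x + 1)"]) auto
  then have "(\<lambda>x. qpoch x p) holomorphic_on UNIV"
    by (auto simp: holomorphic_on_def)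
  from holomorphic_on_compose_gen[OF assms(2) this] show ?thesis by (simp add: o_def)
qed

lemma qpoch_rec:
  assumes "norm p < 1"
  shows "qpoch x p = (1 - x) * qpoch (p * x) p"
proof (rule LIMSEQ_unique)
  show "(\<lambda>n. \<Prod>j<Suc n. 1 - x * p ^ j) \<longlonglongrightarrow> qpoch x p"
    by (rule LIMSEQ_Suc[OF qpoch_LIMSEQ[OF assms]])
  show "(\<lambda>n. \<Prod>j<Suc n. 1 - x * p ^ j) \<longlonglongrightarrow> (1 - x) * qpoch (p * x) p"
    unfolding prod.lessThan_Suc_shift using qpoch_LIMSEQ[OF assms, of "p * x"]
    by (intro tendsto_intros) (auto simp: algebra_simps)
qed

lemma norm_power_less_one:
  fixes q :: "'a :: real_normed_div_algebra"
  assumes "norm q < 1" "k > 0"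
  shows "norm (q ^ k) < 1"
  using assms by (simp add: norm_power power_less_one_iff)

lemma norm_mult_power_less_one:
  fixes p x :: "'a :: real_normed_div_algebra"
  assumes "norm p < 1" "norm x < 1"
  shows "norm (x * p ^ j) < 1"
  using mult_right_le_one_le[of "norm x" "norm p ^ j"] assms
  by (simp add: norm_mult norm_power power_le_one)

lemma qpoch_nonzero:
  assumes "norm p < 1" "norm x < 1"
  shows "qpoch x p \<noteq> 0"
  unfolding qpoch_def using norm_mult_power_less_one[OF assms]
  by (intro prodinf_nonzero convergent_prod_qpoch assms)
    (metis eq_iff_diff_eq_0 norm_one order_less_irrefl)

lemma euler_nonzero: "norm q < 1 \<Longrightarrow> euler q \<noteq> 0"
  unfolding euler_def by (intro qpoch_nonzero)

lemma koebe_sums: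
  assumes "norm v < 1"
  shows "(\<lambda>n. of_nat n * v ^ n) sums koebe v"
proof -
  have "(\<lambda>n. v * (of_nat (Suc n) * v ^ n)) sums (v * (1 / (1 - v)\<^sup>2))"
    by (intro sums_mult geometric_deriv_sums assms)
  then have "(\<lambda>n. of_nat (Suc n) * v ^ Suc n) sums koebe v"
    by (simp add: koebe_def algebra_simps)
  then show ?thesis
    by (subst (asm) sums_Suc_iff) simp
qed

lemma koebe_inverse: "koebe (1 / v) = koebe v"
  by (cases "v = 0"; cases "v = 1") (auto simp: koebe_def field_simps power2_eq_square)

lemma one_minus_power_nonzero:
  fixes p :: "'a :: real_normed_div_algebra"
  assumes "norm p < 1" "n > 0"
  shows "1 - p ^ n \<noteq> 0"
  using norm_power_less_one[OF assms] by auto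

lemma summable_lambert:
  fixes p x :: "'a :: {real_normed_field, banach}"
  assumes p: "norm p < 1" and x: "norm x < 1"
  shows "summable (\<lambda>n. of_nat n / (1 - p ^ n) * x ^ n)"
proof (rule summable_comparison_test'[where N = 0])
  show "summable (\<lambda>n. 1 / (1 - norm p) * (real n * norm x ^ n))"
    using summable_mult[OF sums_summable[OF geometric_deriv_sums[of "norm x"]], of "norm x"] x
    by (intro summable_mult, subst summable_Suc_iff[symmetric]) (simp add: mult_ac)
  show "norm (of_nat n / (1 - p ^ n) * x ^ n) \<le> 1 / (1 - norm p) * (real n * norm x ^ n)" for n
  proof (cases "n = 0")
    case False
    have "1 - norm p \<le> 1 - norm p ^ n"
      using power_decreasing[of 1 n "norm p"] False p by simp
    also have "\<dots> \<le> norm (1 - p ^ n)"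
      by (metis norm_one norm_power norm_triangle_ineq2)
    finally have "real n * norm x ^ n / norm (1 - p ^ n) \<le> real n * norm x ^ n / (1 - norm p)"
      using p by (intro divide_left_mono mult_pos_pos) auto
    then show ?thesis by (simp add: norm_divide norm_mult norm_power)
  qed simp
qed

text \<open>The right-hand side is a power series \<open>V x\<close> with \<open>V x - V (p x) = koebe x\<close>, so the sum on
  the left telescopes.\<close>

lemma koebe_sums_lambert:
  assumes p: "norm p < 1" and x: "norm x < 1"
  shows "(\<lambda>j. koebe (x * p ^ j)) sums (\<Sum>n. of_nat n / (1 - p ^ n) * x ^ n)"
proof -
  define a :: "nat \<Rightarrow> complex" where "a n = of_nat n / (1 - p ^ n)" for n
  define V where "V x = (\<Sum>n. a n * x ^ n)" for x
  have summable: "summable (\<lambda>n. a n * y ^ n)" if "norm y < 1" for y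
    unfolding a_def by (rule summable_lambert[OF p that])
  have V_diff: "V y - V (y * p) = koebe y" if y: "norm y < 1" for y
  proof -
    have "norm (y * p) < 1"
      using norm_mult_power_less_one[OF p y, of 1] by simp
    then have "(\<lambda>n. a n * y ^ n - a n * (y * p) ^ n) sums (V y - V (y * p))"
      unfolding V_def by (intro sums_diff summable_sums summable y)
    moreover have "a n * y ^ n - a n * (y * p) ^ n = of_nat n * y ^ n" for n
      using one_minus_power_nonzero[OF p, of n]
      by (cases "n = 0") (simp_all add: a_def power_mult_distrib divide_simps, algebra)
    ultimately show ?thesis using koebe_sums[OF y] sums_unique2 by simp
  qed
  have "isCont V 0"
    unfolding V_def by (rule isCont_powser[OF summable[of "1 / 2"]]) (simp_all add: norm_divide)
  moreover have "(\<lambda>j. x * p ^ j) \<longlonglongrightarrow> 0"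
    using tendsto_mult_right_zero[OF LIMSEQ_power_zero[OF p]] .
  ultimately have "(\<lambda>j. V (x * p ^ j)) \<longlonglongrightarrow> V 0"
    by (rule isCont_tendsto_compose)
  from telescope_sums'[OF this]
  have "(\<lambda>j. V (x * p ^ j) - V (x * p ^ j * p)) sums (V x - V 0)"
    by (simp add: mult_ac)
  moreover have "V 0 = 0"
    unfolding V_def powser_zero by (simp add: a_def)
  ultimately show ?thesis
    by (simp add: V_diff norm_mult_power_less_one[OF p x]) (simp add: V_def a_def)
qed

lemma
  assumes "norm p < 1" "norm x < 1"
  shows koebe_sum_sums: "(\<lambda>j. koebe (x * p ^ j)) sums koebe_sum x p"
    and koebe_sum_eq_lambert: "koebe_sum x p = (\<Sum>n. of_nat n / (1 - p ^ n) * x ^ n)"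
  using koebe_sums_lambert[OF assms] by (auto simp: koebe_sum_def sums_iff)

lemma koebe_sum_rec:
  assumes "norm p < 1" "norm (p * x) < 1"
  shows "koebe_sum x p = koebe x + koebe_sum (p * x) p"
proof -
  have "(\<lambda>j. koebe (x * p ^ Suc j)) sums koebe_sum (p * x) p"
    using koebe_sum_sums[OF assms] by (simp add: mult_ac)
  then show ?thesis
    by (subst (asm) sums_Suc_iff) (auto simp: koebe_sum_def sums_iff)
qed

lemma koebe_sum_holomorphic [holomorphic_intros]:
  assumes p: "norm p < 1" and f: "f holomorphic_on S" "\<And>w. w \<in> S \<Longrightarrow> norm (f w) < 1"
  shows "(\<lambda>w. koebe_sum (f w) p) holomorphic_on S"
proof -
  have "(\<lambda>x. koebe_sum x p) holomorphic_on ball 0 1"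
    by (rule power_series_holomorphic[where a = "\<lambda>n. of_nat n / (1 - p ^ n)"])
      (use summable_sums[OF summable_lambert[OF p]] in \<open>simp add: koebe_sum_eq_lambert[OF p]\<close>)
  from holomorphic_on_compose_gen[OF f(1) this] f(2) show ?thesis by (force simp: o_def)
qed

text \<open>Empty for \<open>p = 0\<close>, where \<open>1 / norm p = 0\<close>.\<close>

definition annulus :: "complex \<Rightarrow> complex set" where
  "annulus p = {x. norm p < norm x \<and> norm x < 1 / norm p}"

lemma annulusD:
  assumes "x \<in> annulus p"
  shows "x \<noteq> 0" "p \<noteq> 0" "norm (p * x) < 1" "norm (p / x) < 1"
proof -
  show "x \<noteq> 0" "p \<noteq> 0" using assms by (auto simp: annulus_def)
  with assms show "norm (p * x) < 1" "norm (p / x) < 1"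
    by (simp_all add: annulus_def norm_mult norm_divide field_simps)
qed

lemma open_annulus: "open (annulus p)"
  unfolding annulus_def
  by (intro open_Collect_conj open_Collect_less continuous_intros)

lemma connected_annulus_complex: "connected (annulus p)"
  using connected_annulus(1)[of "norm p" "0 :: complex" "1 / norm p"] by (simp add: annulus_def)

lemma annulus_compact_representatives:
  assumes "p \<noteq> 0" "norm p < 1"
  obtains K where "compact K" "K \<noteq> {}" "K \<subseteq> annulus p"
    "\<And>x. x \<in> annulus p \<Longrightarrow> x \<in> K \<or> p * x \<in> K \<or> x / p \<in> K"
proof -
  define s where "s = sqrt (norm p)"
  define K where "K = {x::complex. s \<le> norm x \<and> norm x \<le> 1 / s}"
  have s: "0 < s" "s < 1" "norm p = s * s" using assms by (auto simp: s_def)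
  have s': "s * s < s" "1 < 1 / s" "1 / s < 1 / (s * s)"
    using s by (auto simp: field_simps)
  have K_eq: "K = cball 0 (1 / s) - ball 0 s"
    by (auto simp: K_def)
  show ?thesis
  proof
    show "compact K" unfolding K_eq by (intro compact_diff) auto
    have "1 \<in> K" using s s'(2) by (simp add: K_def)
    then show "K \<noteq> {}" by blast
    show "K \<subseteq> annulus p"
      unfolding K_def annulus_def s(3) using s' by (intro Collect_mono) linarith
    show "x \<in> K \<or> p * x \<in> K \<or> x / p \<in> K" if x: "x \<in> annulus p" for x
    proof -
      consider "norm x < s" | "norm x > 1 / s" | "x \<in> K" by (force simp: K_def)
      then show ?thesis
      proof cases
        case 1
        moreover have "s * s * s \<le> s * s" using mult_left_le[of s "s * s"] s by simp
        ultimately have "s * s * s \<le> norm x"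
          using x unfolding annulus_def s(3) mem_Collect_eq by linarith
        with 1 have "x / p \<in> K"
          using s by (simp add: K_def norm_divide field_simps)
        then show ?thesis by blast
      next
        case 2
        then have "s \<le> s * s * norm x" using s by (simp add: field_simps)
        moreover have "s * s * norm x < 1" using x s by (simp add: annulus_def field_simps)
        ultimately have "p * x \<in> K"
          using s'(2) unfolding K_def norm_mult s(3) mem_Collect_eq by linarith
        then show ?thesis by blast
      qed blast
    qed
  qed
qed

lemma constant_on_annulus:
  assumes p: "p \<noteq> 0" "norm p < 1" and holo: "f holomorphic_on annulus p"
    and shift: "\<And>x. x \<in> annulus p \<Longrightarrow> p * x \<in> annulus p \<Longrightarrow> f (p * x) = f x"
  shows "f constant_on annulus p"
proof -
  obtain K where K: "compact K" "K \<noteq> {}" "K \<subseteq> annulus p"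
    "\<And>x. x \<in> annulus p \<Longrightarrow> x \<in> K \<or> p * x \<in> K \<or> x / p \<in> K"
    using annulus_compact_representatives[OF p] by metis
  have "continuous_on K (\<lambda>x. norm (f x))"
    using holomorphic_on_imp_continuous_on[OF holomorphic_on_subset[OF holo K(3)]]
    by (intro continuous_intros)
  then obtain \<xi> where \<xi>: "\<xi> \<in> K" "\<And>x. x \<in> K \<Longrightarrow> norm (f x) \<le> norm (f \<xi>)"
    using continuous_attains_sup[OF K(1,2)] by blast
  have "norm (f x) \<le> norm (f \<xi>)" if x: "x \<in> annulus p" for x
    using K(4)[OF x]
  proof (elim disjE)
    assume "p * x \<in> K"
    then show ?thesis using \<xi>(2) shift[OF x] K(3) by force
  next
    assume "x / p \<in> K"
    then show ?thesis using \<xi>(2) shift[of "x / p"] K(3) x p by force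
  qed (rule \<xi>(2))
  then show ?thesis
    using \<xi>(1) K(3) by (intro maximum_modulus_principle[OF holo open_annulus
      connected_annulus_complex open_annulus order_refl]) auto
qed

lemma theta_holomorphic [holomorphic_intros]:
  assumes "norm p < 1" "f holomorphic_on S" "\<And>w. w \<in> S \<Longrightarrow> f w \<noteq> 0"
  shows "(\<lambda>w. theta (f w) p) holomorphic_on S"
  unfolding theta_def using assms by (intro holomorphic_intros)

lemma theta_1 [simp]: "norm p < 1 \<Longrightarrow> theta 1 p = 0"
  using qpoch_rec[of p 1] by (simp add: theta_def)

lemma theta_shift:
  assumes "p \<noteq> 0" "norm p < 1" "x \<noteq> 0"
  shows "theta (p * x) p = - theta x p / x"
proof -
  have "qpoch (1 / x) p = (1 - 1 / x) * qpoch (p / x) p" "qpoch x p = (1 - x) * qpoch (p * x) p"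
    using qpoch_rec[OF assms(2), of "1 / x"] qpoch_rec[OF assms(2), of x] by simp_all
  then have "theta (p * x) p = qpoch (p * x) p * ((1 - 1 / x) * qpoch (p / x) p)"
    "theta x p = (1 - x) * qpoch (p * x) p * qpoch (p / x) p"
    using assms by (simp_all add: theta_def)
  then show ?thesis using assms(3) by (simp only:) (simp add: field_simps)
qed

lemma theta_reflect: "p \<noteq> 0 \<Longrightarrow> theta (p / x) p = theta x p"
  by (cases "x = 0") (auto simp: theta_def)

lemma theta_inverse:
  assumes "p \<noteq> 0" "norm p < 1" "x \<noteq> 0"
  shows "theta (1 / x) p = - theta x p / x"
  using theta_shift[OF assms] theta_reflect[OF assms(1), of "p * x"] assms by simp

definition theta_core :: "complex \<Rightarrow> complex \<Rightarrow> complex" where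
  "theta_core x p = qpoch (p * x) p * qpoch (p / x) p"

lemma theta_eq_core: "norm p < 1 \<Longrightarrow> theta x p = (1 - x) * theta_core x p"
  using qpoch_rec[of p x] by (simp add: theta_def theta_core_def)

lemma theta_core_nonzero:
  assumes "norm p < 1" "x \<in> annulus p"
  shows "theta_core x p \<noteq> 0"
  using annulusD(3,4)[OF assms(2)] assms(1) by (simp add: theta_core_def qpoch_nonzero)

lemma theta_core_inverse: "theta_core (1 / x) p = theta_core x p"
  by (simp add: theta_core_def)

lemma theta_core_holomorphic [holomorphic_intros]:
  assumes "norm p < 1" "f holomorphic_on S" "\<And>w. w \<in> S \<Longrightarrow> f w \<noteq> 0"
  shows "(\<lambda>w. theta_core (f w) p) holomorphic_on S"
  unfolding theta_core_def using assms by (intro holomorphic_intros)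

lemma wp_shift:
  assumes p: "norm p < 1" and x: "x \<in> annulus p"
  shows "wp (p * x) p = wp x p"
proof -
  note x' = annulusD[OF x]
  have "koebe_sum x p = koebe x + koebe_sum (p * x) p"
    by (rule koebe_sum_rec[OF p x'(3)])
  moreover have "koebe_sum (1 / x) p = koebe (1 / x) + koebe_sum (p / x) p"
    using koebe_sum_rec[OF p, of "1 / x"] x'(4) by simp
  ultimately show ?thesis using x' by (simp add: wp_def koebe_inverse)
qed

lemma deriv_at_1_inversion:
  assumes A: "open A" "1 \<in> A" and f: "f holomorphic_on A"
    and inversion: "\<And>w. w \<in> A \<Longrightarrow> f w = w ^ 2 * f (1 / w)"
  shows "deriv f 1 = f 1"
proof -
  have f': "(f has_field_derivative deriv f 1) (at 1)"
    using holomorphic_derivI[OF f A] .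
  then have "((\<lambda>w. w ^ 2 * f (1 / w)) has_field_derivative 2 * f 1 - deriv f 1) (at 1)"
    by (auto intro!: derivative_eq_intros DERIV_chain'[where g = f and f = "\<lambda>w. 1 / w"])
  then have "(f has_field_derivative 2 * f 1 - deriv f 1) (at 1)"
    by (rule has_field_derivative_transform_within_open[OF _ A]) (simp flip: inversion)
  from DERIV_unique[OF this f'] show ?thesis by simp
qed

lemma theta_quotient_shift:
  assumes p: "p \<noteq> 0" "norm p < 1" and w: "w \<noteq> 0" and y: "y \<noteq> 0"
  shows "theta (p * w * y) p * theta (p * w / y) p / theta (p * w) p ^ 2 =
    theta (w * y) p * theta (w / y) p / theta w p ^ 2"
proof -
  have "theta (p * w * y) p = - theta (w * y) p / (w * y)"
    "theta (p * w / y) p = - theta (w / y) p / (w / y)"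
    using theta_shift[OF p, of "w * y"] theta_shift[OF p, of "w / y"] w y
    by (simp_all add: mult.assoc)
  then show ?thesis using w y by (simp add: theta_shift[OF p w] power2_eq_square)
qed

lemma theta_quotient_inversion:
  assumes p: "p \<noteq> 0" "norm p < 1" and w: "w \<noteq> 0" and y: "y \<noteq> 0"
  shows "theta (w * y) p * theta (w / y) p = w ^ 2 * (theta (1 / w * y) p * theta (1 / w / y) p)"
proof -
  have "theta (1 / w * y) p = - theta (w / y) p / (w / y)"
    "theta (1 / w / y) p = - theta (w * y) p / (w * y)"
    using theta_inverse[OF p, of "w / y"] theta_inverse[OF p, of "w * y"] w y by simp_all
  then show ?thesis using w y by (simp add: power2_eq_square)
qed

text \<open>The symmetry under \<open>w \<mapsto> 1/w\<close> excludes a simple pole at 1.\<close>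

lemma theta_quotient_principal_part:
  assumes p: "p \<noteq> 0" "norm p < 1" and y: "y \<noteq> 0"
  defines "C \<equiv> theta y p * theta (1 / y) p / euler p ^ 4"
  obtains H where "H holomorphic_on annulus p"
    "\<And>w. w \<in> annulus p \<Longrightarrow> w \<noteq> 1 \<Longrightarrow>
      theta (w * y) p * theta (w / y) p / theta w p ^ 2 = H w + C * koebe w"
proof -
  define N where "N w = theta (w * y) p * theta (w / y) p / theta_core w p ^ 2" for w
  have one: "1 \<in> annulus p" using p by (simp add: annulus_def field_simps)
  note nz = annulusD(1)[of _ p] theta_core_nonzero[OF p(2)]
  have N: "N holomorphic_on annulus p"
    unfolding N_def by (intro holomorphic_intros p(2)) (simp_all add: nz y)
  have N_1: "N 1 = C"
    by (simp add: N_def C_def theta_core_def euler_def power4_eq_xxxx power2_eq_square)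
  have "N w = w ^ 2 * N (1 / w)" if "w \<in> annulus p" for w
    using theta_quotient_inversion[OF p nz(1)[OF that] y] by (simp add: N_def theta_core_inverse)
  then have "deriv N 1 = C"
    using deriv_at_1_inversion[OF open_annulus one N] N_1 by simp
  then have "deriv (\<lambda>w. N w - C * w) 1 = 0"
    using holomorphic_derivI[OF N open_annulus one]
    by (intro DERIV_imp_deriv) (auto intro!: derivative_eq_intros)
  then obtain H where H: "H holomorphic_on annulus p"
    "\<And>w. w \<noteq> 1 \<Longrightarrow> H w = (N w - C * w) / (w - 1)\<^sup>2"
    using removable_double_zero[OF open_annulus, of "\<lambda>w. N w - C * w" p 1] N N_1
    by (auto intro: holomorphic_intros)
  show ?thesis
  proof (rule that[OF H(1)])
    fix w assume w: "w \<in> annulus p" "w \<noteq> 1"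
    have "theta (w * y) p * theta (w / y) p / theta w p ^ 2 = N w / (1 - w)\<^sup>2"
      by (simp add: N_def theta_eq_core[OF p(2), of w] power_mult_distrib)
    then show "theta (w * y) p * theta (w / y) p / theta w p ^ 2 = H w + C * koebe w"
      using w(2) by (simp add: H(2) koebe_def power2_commute[of w 1] diff_divide_distrib)
  qed
qed

lemma theta_quotient_eq_wp_diff:
  assumes p: "norm p < 1" and x: "x \<in> annulus p" "x \<noteq> 1" and y: "y \<in> annulus p" "y \<noteq> 1"
  shows "theta (x * y) p * theta (x / y) p / theta x p ^ 2 =
    theta y p * theta (1 / y) p / euler p ^ 4 * (wp x p - wp y p)"
proof -
  note y0 = annulusD(1)[OF y(1)] and p0 = annulusD(2)[OF x(1)]
  define C where "C = theta y p * theta (1 / y) p / euler p ^ 4"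
  define R where "R w = theta (w * y) p * theta (w / y) p / theta w p ^ 2" for w
  obtain H where H: "H holomorphic_on annulus p"
    "\<And>w. w \<in> annulus p \<Longrightarrow> w \<noteq> 1 \<Longrightarrow> R w = H w + C * koebe w"
    unfolding R_def C_def by (rule theta_quotient_principal_part[OF p0 p y0]) blast
  define F where "F w = H w - C * (koebe_sum (p * w) p + koebe_sum (p / w) p)" for w
  have F: "F w = R w - C * wp w p" if "w \<in> annulus p" "w \<noteq> 1" for w
    using H(2)[OF that] koebe_sum_rec[OF p, of w] annulusD(3)[OF that(1)]
    by (simp add: F_def wp_def algebra_simps)
  have "F constant_on annulus p"
  proof (rule constant_on_annulus[OF p0 p])
    show "F holomorphic_on annulus p"
      unfolding F_def using annulusD by (intro holomorphic_intros H p) auto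
    show "F (p * w) = F w" if w: "w \<in> annulus p" "p * w \<in> annulus p" for w
    proof -
      have "w \<noteq> 1" "p * w \<noteq> 1"
        using w(2) annulusD(3)[OF w(1)] by (auto simp: annulus_def)
      moreover have "R (p * w) = R w"
        unfolding R_def by (rule theta_quotient_shift[OF p0 p annulusD(1)[OF w(1)] y0])
      ultimately show ?thesis by (simp add: F w wp_shift[OF p w(1)])
    qed
  qed
  then have "F x = F y" using x y by (auto simp: constant_on_def)
  moreover have "R y = 0" using y0 p by (simp add: R_def)
  ultimately have "R x = C * (wp x p - wp y p)"
    by (simp add: F[OF x] F[OF y] algebra_simps)
  then show ?thesis by (simp only: R_def C_def)
qed

lemma wp_diff:
  assumes p: "norm p < 1" and x: "x \<in> annulus p" "x \<noteq> 1" and y: "y \<in> annulus p" "y \<noteq> 1"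
  shows "wp y p - wp x p =
    y * theta (x * y) p * theta (x / y) p * euler p ^ 4 / (theta x p * theta y p) ^ 2"
proof -
  note y0 = annulusD(1)[OF y(1)] and p0 = annulusD(2)[OF x(1)]
  have nz: "theta x p \<noteq> 0" "theta y p \<noteq> 0" "euler p \<noteq> 0"
    using theta_core_nonzero[OF p] euler_nonzero[OF p] x y by (simp_all add: theta_eq_core[OF p])
  have "y * theta (x * y) p * theta (x / y) p * euler p ^ 4 / (theta x p * theta y p) ^ 2 =
      y * (theta (x * y) p * theta (x / y) p / theta x p ^ 2) * euler p ^ 4 / theta y p ^ 2"
    by (simp add: power_mult_distrib)
  also have "\<dots> = wp y p - wp x p"
    unfolding theta_quotient_eq_wp_diff[OF assms] theta_inverse[OF p0 p y0]
    using nz y0 by (simp add: power2_eq_square)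
  finally show ?thesis ..
qed

section \<open>Theta values at \<open>q, q\<^sup>2, q\<^sup>3\<close> for the nome \<open>q\<^sup>6\<close>\<close>

lemma qpoch_multisection:
  assumes p: "norm p < 1" and n: "n > 0"
  shows "qpoch x p = (\<Prod>i<n. qpoch (x * p ^ i) (p ^ n))"
proof (rule LIMSEQ_unique)
  have "strict_mono (\<lambda>N. N * n)" using n by (simp add: strict_mono_def)
  from LIMSEQ_subseq_LIMSEQ[OF qpoch_LIMSEQ[OF p] this]
  show "(\<lambda>N. \<Prod>j<N * n. 1 - x * p ^ j) \<longlonglongrightarrow> qpoch x p" by (simp add: o_def)
  have "(\<lambda>N. \<Prod>i<n. \<Prod>j<N. 1 - x * p ^ i * (p ^ n) ^ j) \<longlonglongrightarrow>
      (\<Prod>i<n. qpoch (x * p ^ i) (p ^ n))"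
    by (intro tendsto_prod qpoch_LIMSEQ norm_power_less_one p n)
  also have "(\<lambda>N. \<Prod>i<n. \<Prod>j<N. 1 - x * p ^ i * (p ^ n) ^ j) = (\<lambda>N. \<Prod>j<N * n. 1 - x * p ^ j)"
  proof
    fix N
    have "(\<Prod>i<n. \<Prod>j<N. 1 - x * p ^ i * (p ^ n) ^ j) = (\<Prod>j<N. \<Prod>i<n. 1 - x * p ^ (i + j * n))"
      by (subst prod.swap) (simp add: power_add mult_ac flip: power_mult)
    also have "\<dots> = (\<Prod>j<N. \<Prod>i=j * n..<j * n + n. 1 - x * p ^ i)"
      using prod.shift_bounds_nat_ivl[of "\<lambda>i. 1 - x * p ^ i" 0 _ n]
      by (simp add: atLeast0LessThan add.commute[of n])
    finally show "(\<Prod>i<n. \<Prod>j<N. 1 - x * p ^ i * (p ^ n) ^ j) = (\<Prod>j<N * n. 1 - x * p ^ j)"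
      by (simp add: prod.nat_group)
  qed
  finally show "(\<lambda>N. \<Prod>j<N * n. 1 - x * p ^ j) \<longlonglongrightarrow> (\<Prod>i<n. qpoch (x * p ^ i) (p ^ n))" .
qed

lemma koebe_sum_multisection:
  assumes p: "norm p < 1" and x: "norm x < 1" and n: "n > 0"
  shows "koebe_sum x p = (\<Sum>i<n. koebe_sum (x * p ^ i) (p ^ n))"
proof (rule sums_unique2)
  show "(\<lambda>j. \<Sum>i=j * n..<j * n + n. koebe (x * p ^ i)) sums koebe_sum x p"
    by (rule sums_group[OF koebe_sum_sums[OF p x] n])
  have "(\<lambda>j. \<Sum>i<n. koebe (x * p ^ i * (p ^ n) ^ j)) sums (\<Sum>i<n. koebe_sum (x * p ^ i) (p ^ n))"
    by (intro sums_sum koebe_sum_sums norm_mult_power_less_one norm_power_less_one p x n)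
  moreover have "x * p ^ i * (p ^ n) ^ j = x * p ^ (i + j * n)" for i j
    by (simp add: power_add mult_ac flip: power_mult)
  ultimately show "(\<lambda>j. \<Sum>i=j * n..<j * n + n. koebe (x * p ^ i)) sums
      (\<Sum>i<n. koebe_sum (x * p ^ i) (p ^ n))"
    using sum.shift_bounds_nat_ivl[of "\<lambda>i. koebe (x * p ^ i)" 0 _ n]
    by (simp add: atLeast0LessThan add.commute[of n])
qed

definition lambert :: "complex \<Rightarrow> complex" where
  "lambert q = koebe_sum q q"

lemma lambert_sums:
  assumes "norm q < 1"
  shows "(\<lambda>j. of_nat (Suc j) * q ^ Suc j / (1 - q ^ Suc j)) sums lambert q"
proof -
  have "(\<lambda>n. of_nat n * q ^ n / (1 - q ^ n)) sums lambert q"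
    using summable_sums[OF summable_lambert[OF assms assms]]
    by (simp add: lambert_def koebe_sum_eq_lambert[OF assms assms])
  then show ?thesis by (subst sums_Suc_iff) simp
qed

lemma ramanujan_P_eq_lambert: "norm q < 1 \<Longrightarrow> ramanujan_P q = 1 - 24 * lambert q"
  using sums_unique[OF lambert_sums] by (simp add: ramanujan_P_def)

lemma
  assumes "norm q < 1" "k > 0" "n > 0"
  shows euler_power_multisection:
      "euler (q ^ k) = (\<Prod>i<n. qpoch (q ^ (k * Suc i)) (q ^ (k * n)))"
    and lambert_power_multisection:
      "lambert (q ^ k) = (\<Sum>i<n. koebe_sum (q ^ (k * Suc i)) (q ^ (k * n)))"
  using qpoch_multisection[of "q ^ k" n "q ^ k"] koebe_sum_multisection[of "q ^ k" "q ^ k" n]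
    norm_power_less_one[OF assms(1,2)] assms(3)
  by (simp_all add: euler_def lambert_def power_add power_mult)

lemma
  assumes q: "q \<noteq> 0" "norm q < 1"
  shows theta_q1_q6: "theta q (q ^ 6) = euler q * euler (q ^ 6) / (euler (q ^ 2) * euler (q ^ 3))"
    and theta_q2_q6: "theta (q ^ 2) (q ^ 6) = euler (q ^ 2) / euler (q ^ 6)"
    and theta_q3_q6: "theta (q ^ 3) (q ^ 6) = (euler (q ^ 3) / euler (q ^ 6)) ^ 2"
proof -
  define A where "A i = qpoch (q ^ i) (q ^ 6)" for i
  have nz: "A i \<noteq> 0" if "i > 0" for i
    unfolding A_def using q that by (intro qpoch_nonzero norm_power_less_one) auto
  have "euler (q ^ k) = (\<Prod>i<n. A (k * Suc i))" if "0 < k" "0 < n" "k * n = 6" for k n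
    using euler_power_multisection[OF q(2) that(1,2)] by (simp only: A_def that(3))
  from this[of 1 6] this[of 2 3] this[of 3 2] this[of 6 1]
  have euler_A: "euler q = A 1 * A 2 * A 3 * A 4 * A 5 * A 6" "euler (q ^ 2) = A 2 * A 4 * A 6"
    "euler (q ^ 3) = A 3 * A 6" "euler (q ^ 6) = A 6"
    by (simp_all add: lessThan_nat_numeral mult_ac flip: numeral_2_eq_2)
  have theta_A: "theta q (q ^ 6) = A 1 * A 5" "theta (q ^ 2) (q ^ 6) = A 2 * A 4"
    "theta (q ^ 3) (q ^ 6) = A 3 * A 3"
    using q by (simp_all add: theta_def A_def eval_nat_numeral)
  show "theta q (q ^ 6) = euler q * euler (q ^ 6) / (euler (q ^ 2) * euler (q ^ 3))"
    "theta (q ^ 2) (q ^ 6) = euler (q ^ 2) / euler (q ^ 6)"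
    using nz by (simp_all add: theta_A euler_A)
  show "theta (q ^ 3) (q ^ 6) = (euler (q ^ 3) / euler (q ^ 6)) ^ 2"
    using nz by (simp add: theta_A euler_A power2_eq_square)
qed

lemma
  assumes q: "q \<noteq> 0" "norm q < 1"
  shows wp_q1_q6: "wp q (q ^ 6) = lambert q - lambert (q ^ 2) - lambert (q ^ 3) + lambert (q ^ 6)"
    and wp_q2_q6: "wp (q ^ 2) (q ^ 6) = lambert (q ^ 2) - lambert (q ^ 6)"
    and wp_q3_q6: "wp (q ^ 3) (q ^ 6) = 2 * (lambert (q ^ 3) - lambert (q ^ 6))"
proof -
  define A where "A i = koebe_sum (q ^ i) (q ^ 6)" for i
  have "lambert (q ^ k) = (\<Sum>i<n. A (k * Suc i))" if "0 < k" "0 < n" "k * n = 6" for k n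
    using lambert_power_multisection[OF q(2) that(1,2)] by (simp only: A_def that(3))
  from this[of 1 6] this[of 2 3] this[of 3 2] this[of 6 1]
  have lambert_A: "lambert q = A 1 + A 2 + A 3 + A 4 + A 5 + A 6"
    "lambert (q ^ 2) = A 2 + A 4 + A 6" "lambert (q ^ 3) = A 3 + A 6" "lambert (q ^ 6) = A 6"
    by (simp_all add: lessThan_nat_numeral add_ac flip: numeral_2_eq_2)
  have "wp q (q ^ 6) = A 1 + A 5" "wp (q ^ 2) (q ^ 6) = A 2 + A 4" "wp (q ^ 3) (q ^ 6) = A 3 + A 3"
    using q by (simp_all add: wp_def A_def eval_nat_numeral)
  then show "wp q (q ^ 6) = lambert q - lambert (q ^ 2) - lambert (q ^ 3) + lambert (q ^ 6)"
    "wp (q ^ 2) (q ^ 6) = lambert (q ^ 2) - lambert (q ^ 6)"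
    "wp (q ^ 3) (q ^ 6) = 2 * (lambert (q ^ 3) - lambert (q ^ 6))"
    by (simp_all add: lambert_A)
qed

lemma power_in_annulus:
  assumes q: "q \<noteq> 0" "norm q < 1" and "i < n"
  shows "q ^ i \<in> annulus (q ^ n)"
proof -
  have "norm q ^ n < norm q ^ i" "norm q ^ n * norm q ^ i < 1"
    using q assms(3) power_strict_decreasing[of i n "norm q"]
      power_less_one_iff[of "norm q" "n + i"]
    by (simp_all flip: power_add)
  then show ?thesis using q by (simp add: annulus_def norm_power field_simps)
qed

lemma theta_reflect_power:
  assumes "q \<noteq> 0" "i + j = n"
  shows "theta (q ^ j) (q ^ n) = theta (q ^ i) (q ^ n)"
  using theta_reflect[of "q ^ n" "q ^ i"] assms(1) by (simp add: power_add flip: assms(2))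

lemma wp_diff_powers:
  assumes q: "q \<noteq> 0" "norm q < 1"
    and ij: "0 < i" "0 < j" "i < n" "j < n" and lm: "m = j + i" "j = l + i"
  shows "wp (q ^ i) (q ^ n) - wp (q ^ j) (q ^ n) =
      q ^ i * theta (q ^ m) (q ^ n) * theta (q ^ l) (q ^ n) * euler (q ^ n) ^ 4 /
        (theta (q ^ j) (q ^ n) * theta (q ^ i) (q ^ n)) ^ 2"
proof -
  have small: "norm (q ^ k) < 1" if "k > 0" for k
    by (rule norm_power_less_one[OF q(2) that])
  have annulus: "q ^ k \<in> annulus (q ^ n)" and ne_1: "q ^ k \<noteq> 1" if "0 < k" "k < n" for k
    using power_in_annulus[OF q that(2)] small[OF that(1)] by auto
  have "q ^ j * q ^ i = q ^ m" "q ^ j / q ^ i = q ^ l"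
    using lm q by (simp_all add: power_add)
  with wp_diff[OF small[of n] annulus ne_1 annulus ne_1, of j i] ij show ?thesis
    by simp
qed

definition eta_quot :: "(nat \<times> int) list \<Rightarrow> complex \<Rightarrow> complex" where
  "eta_quot rs q = (\<Prod>(k, r)\<leftarrow>rs. euler (q ^ k) powi r)"

text \<open>The four eta quotients of weight 1 for \<open>\<Gamma>\<^sub>0(6)\<close>, each named after the only cusp (0, 1/2, 1/3
  or \<open>\<infinity>\<close>) at which it vanishes.\<close>

definition wt1_zero :: "complex \<Rightarrow> complex" where
  "wt1_zero = eta_quot [(1, 6), (2, - 3), (3, - 2), (6, 1)]"

definition wt1_half :: "complex \<Rightarrow> complex" where
  "wt1_half = eta_quot [(1, - 3), (2, 6), (3, 1), (6, - 2)]"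

definition wt1_third :: "complex \<Rightarrow> complex" where
  "wt1_third = eta_quot [(1, - 2), (2, 1), (3, 6), (6, - 3)]"

definition wt1_infty :: "complex \<Rightarrow> complex" where
  "wt1_infty q = q * eta_quot [(1, 1), (2, - 2), (3, - 3), (6, 6)] q"

lemma
  assumes q: "q \<noteq> 0" "norm q < 1"
  shows wt1_third_infty:
      "wt1_third q * wt1_infty q = wp q (q ^ 6) - wp (q ^ 2) (q ^ 6)"
    and wt1_half_infty:
      "wt1_half q * wt1_infty q = wp q (q ^ 6) - wp (q ^ 3) (q ^ 6)"
    and wt1_infty_square:
      "wt1_infty q ^ 2 = wp (q ^ 2) (q ^ 6) - wp (q ^ 3) (q ^ 6)"
proof -
  have nz: "euler q \<noteq> 0" "euler (q ^ 2) \<noteq> 0" "euler (q ^ 3) \<noteq> 0" "euler (q ^ 6) \<noteq> 0"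
    using euler_nonzero[OF q(2)] euler_nonzero[OF norm_power_less_one[OF q(2)]] by simp_all
  have theta_4: "theta (q ^ 4) (q ^ 6) = theta (q ^ 2) (q ^ 6)"
    and theta_5: "theta (q ^ 5) (q ^ 6) = theta q (q ^ 6)"
    using theta_reflect_power[OF q(1), of 2 4 6] theta_reflect_power[OF q(1), of 1 5 6] by auto
  note wt1_simps = wt1_half_def wt1_third_def wt1_infty_def eta_quot_def power_int_minus
    theta_q1_q6[OF q] theta_q2_q6[OF q] theta_q3_q6[OF q] theta_4 theta_5
  have "wp q (q ^ 6) - wp (q ^ 2) (q ^ 6) = q * theta (q ^ 3) (q ^ 6) * theta q (q ^ 6) *
      euler (q ^ 6) ^ 4 / (theta (q ^ 2) (q ^ 6) * theta q (q ^ 6)) ^ 2"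
    by (rule wp_diff_powers[OF q, of 1 2 6 3 1, unfolded power_one_right]) simp_all
  also have "\<dots> = wt1_third q * wt1_infty q"
    using nz by (simp add: wt1_simps divide_simps) algebra
  finally show "wt1_third q * wt1_infty q = wp q (q ^ 6) - wp (q ^ 2) (q ^ 6)" ..
  have "wp q (q ^ 6) - wp (q ^ 3) (q ^ 6) = q * theta (q ^ 4) (q ^ 6) * theta (q ^ 2) (q ^ 6) *
      euler (q ^ 6) ^ 4 / (theta (q ^ 3) (q ^ 6) * theta q (q ^ 6)) ^ 2"
    by (rule wp_diff_powers[OF q, of 1 3 6 4 2, unfolded power_one_right]) simp_all
  also have "\<dots> = wt1_half q * wt1_infty q"
    using nz by (simp add: wt1_simps divide_simps) algebra
  finally show "wt1_half q * wt1_infty q = wp q (q ^ 6) - wp (q ^ 3) (q ^ 6)" ..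
  have "wp (q ^ 2) (q ^ 6) - wp (q ^ 3) (q ^ 6) = q ^ 2 * theta (q ^ 5) (q ^ 6) * theta q (q ^ 6) *
      euler (q ^ 6) ^ 4 / (theta (q ^ 3) (q ^ 6) * theta (q ^ 2) (q ^ 6)) ^ 2"
    by (rule wp_diff_powers[OF q, of 2 3 6 5 1, unfolded power_one_right]) simp_all
  also have "\<dots> = wt1_infty q ^ 2"
    using nz by (simp add: wt1_simps divide_simps) algebra
  finally show "wt1_infty q ^ 2 = wp (q ^ 2) (q ^ 6) - wp (q ^ 3) (q ^ 6)" ..
qed

section \<open>The operator \<open>q d/dq\<close>\<close>

text \<open>Of use only for \<open>q \<noteq> 0\<close>, since \<open>D / 0 = 0\<close>.\<close>

definition has_qderiv :: "(complex \<Rightarrow> complex) \<Rightarrow> complex \<Rightarrow> complex \<Rightarrow> bool" where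
  "has_qderiv f D q \<longleftrightarrow> (f has_field_derivative D / q) (at q)"

lemma has_qderiv_unique:
  assumes "has_qderiv f D q" "has_qderiv f E q" "q \<noteq> 0"
  shows "D = E"
  using DERIV_unique[of f "D / q" q "E / q"] assms by (simp add: has_qderiv_def)

lemma has_qderiv_eq_rhs: "has_qderiv f D q \<Longrightarrow> D = E \<Longrightarrow> has_qderiv f E q"
  by simp

lemma has_qderiv_diff:
  "has_qderiv f D q \<Longrightarrow> has_qderiv g E q \<Longrightarrow> has_qderiv (\<lambda>q. f q - g q) (D - E) q"
  unfolding has_qderiv_def by (auto intro!: derivative_eq_intros simp: diff_divide_distrib)

lemma has_qderiv_add:
  "has_qderiv f D q \<Longrightarrow> has_qderiv g E q \<Longrightarrow> has_qderiv (\<lambda>q. f q + g q) (D + E) q"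
  unfolding has_qderiv_def by (auto intro!: derivative_eq_intros simp: add_divide_distrib)

lemma has_qderiv_cmult:
  "has_qderiv f D q \<Longrightarrow> has_qderiv (\<lambda>q. c * f q) (c * D) q"
  unfolding has_qderiv_def by (auto intro!: derivative_eq_intros)

lemma has_qderiv_mult:
  "has_qderiv f D q \<Longrightarrow> has_qderiv g E q \<Longrightarrow> has_qderiv (\<lambda>q. f q * g q) (D * g q + f q * E) q"
  unfolding has_qderiv_def by (auto intro!: derivative_eq_intros simp: add_divide_distrib)

lemma has_qderiv_divide:
  assumes "has_qderiv f D q" "has_qderiv g E q" "g q \<noteq> 0"
  shows "has_qderiv (\<lambda>q. f q / g q) ((D * g q - f q * E) / g q ^ 2) q"
  using assms unfolding has_qderiv_def
  by (auto intro!: derivative_eq_intros simp: diff_divide_distrib power2_eq_square mult_ac)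

lemma has_qlogderiv_power_int:
  assumes "has_qderiv f (f q * L) q" "f q \<noteq> 0"
  shows "has_qderiv (\<lambda>q. f q powi r) (f q powi r * (of_int r * L)) q"
  using assms unfolding has_qderiv_def
  by (auto intro!: derivative_eq_intros simp: power_int_diff)

lemma has_qderiv_ident: "q \<noteq> 0 \<Longrightarrow> has_qderiv (\<lambda>q. q) q q"
  by (simp add: has_qderiv_def)

lemma has_qderiv_compose_power:
  assumes "has_qderiv f D (q ^ k)" "k > 0" "q \<noteq> 0"
  shows "has_qderiv (\<lambda>q. f (q ^ k)) (of_nat k * D) q"
proof -
  have "((\<lambda>q. q ^ k) has_field_derivative of_nat k * q ^ (k - 1)) (at q)"
    by (auto intro!: derivative_eq_intros)
  then have "((\<lambda>q. f (q ^ k)) has_field_derivative D / q ^ k * (of_nat k * q ^ (k - 1))) (at q)"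
    using assms(1) unfolding has_qderiv_def by (rule DERIV_chain2[rotated])
  moreover have "D / q ^ k * (of_nat k * q ^ (k - 1)) = of_nat k * D / q"
    using assms(2,3) by (cases k) auto
  ultimately show ?thesis by (simp add: has_qderiv_def)
qed

lemma has_qderiv_transform:
  assumes "has_qderiv f D q" "open S" "q \<in> S" "\<And>w. w \<in> S \<Longrightarrow> f w = g w"
  shows "has_qderiv g D q"
  using assms has_field_derivative_transform_within_open unfolding has_qderiv_def by blast

lemma eq_if_qlogderiv_eq:
  assumes f: "f holomorphic_on ball 0 R" and g: "g holomorphic_on ball 0 R"
    and nz: "\<And>q. q \<in> ball 0 R \<Longrightarrow> g q \<noteq> 0" and "f 0 = g 0"
    and f': "\<And>q. q \<in> ball 0 R - {0} \<Longrightarrow> has_qderiv f (f q * L q) q"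
    and g': "\<And>q. q \<in> ball 0 R - {0} \<Longrightarrow> has_qderiv g (g q * L q) q"
    and q: "q \<in> ball 0 R"
  shows "f q = g q"
proof -
  have "R > 0" using le_less_trans[OF norm_ge_zero, of q R] q by simp
  have "(\<lambda>q. f q / g q) holomorphic_on ball 0 R"
    by (intro holomorphic_intros f g nz)
  moreover have "((\<lambda>q. f q / g q) has_field_derivative 0) (at w)" if "w \<in> ball 0 R - {0}" for w
    using has_qderiv_divide[OF f'[OF that] g'[OF that] nz] that by (simp add: has_qderiv_def)
  ultimately obtain c where c: "\<And>w. w \<in> ball 0 R \<Longrightarrow> f w / g w = c"
    using DERIV_zero_connected_constant[of "ball 0 R" "{0}" "\<lambda>q. f q / g q"]
      holomorphic_on_imp_continuous_on by auto
  have "c = 1" using c[of 0] nz[of 0] \<open>f 0 = g 0\<close> \<open>R > 0\<close> by simp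
  with c[OF q] nz[OF q] show ?thesis by simp
qed

lemma
  assumes q: "norm q < 1"
  shows euler_field_differentiable: "euler field_differentiable at q"
    and euler_logderiv_sums:
      "(\<lambda>j. - (of_nat (Suc j) * q ^ j) / (1 - q ^ Suc j)) sums (deriv euler q / euler q)"
proof -
  have euler_prod: "euler = (\<lambda>q. \<Prod>j. 1 - q ^ Suc j)" by (simp add: euler_def[abs_def] qpoch_def)
  obtain r where r: "norm q < r" "r < 1" using dense[OF q] by blast
  then have q_r: "q \<in> ball 0 r" by simp
  have summable: "summable (\<lambda>k. r * r ^ k)"
    by (rule summable_mult_power) (use r norm_ge_zero[of q] in linarith)+
  have holo: "(\<lambda>q::complex. 1 - q ^ Suc k) holomorphic_on ball 0 r" for k
    by (intro holomorphic_intros)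
  have bound: "norm (1 - x ^ Suc k - 1) \<le> r * r ^ k" if "x \<in> ball 0 r" for x :: complex and k
    using power_mono[of "norm x" r "Suc k"] that by (simp add: norm_mult norm_power)
  have nz: "1 - q ^ Suc k \<noteq> 0" for k by (rule one_minus_power_nonzero[OF q]) simp
  have "euler holomorphic_on ball 0 r"
    unfolding euler_prod by (rule holomorphic_on_prodinf[OF open_ball holo summable bound])
  then show "euler field_differentiable at q"
    using q_r by (intro holomorphic_on_imp_differentiable_at[of _ "ball 0 r"]) auto
  have "(\<lambda>k. deriv (\<lambda>q. 1 - q ^ Suc k) q / (1 - q ^ Suc k)) sums (deriv euler q / euler q)"
    unfolding euler_prod by (rule logderiv_prodinf_sums[OF open_ball holo summable bound q_r nz])
  moreover have "deriv (\<lambda>q. 1 - q ^ Suc k) q = - (of_nat (Suc k) * q ^ k)" for k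
    by (rule DERIV_imp_deriv) (auto intro!: derivative_eq_intros simp del: power_Suc)
  ultimately show
    "(\<lambda>j. - (of_nat (Suc j) * q ^ j) / (1 - q ^ Suc j)) sums (deriv euler q / euler q)"
    by simp
qed

lemma euler_holomorphic: "euler holomorphic_on ball 0 1"
  using euler_field_differentiable
  by (auto simp: holomorphic_on_def intro: field_differentiable_at_within)

lemma has_qderiv_euler:
  assumes q: "q \<noteq> 0" "norm q < 1"
  shows "has_qderiv euler (euler q * - lambert q) q"
proof -
  have "(\<lambda>j. - q * (- (of_nat (Suc j) * q ^ j) / (1 - q ^ Suc j))) sums
      (- q * (deriv euler q / euler q))"
    by (intro sums_mult euler_logderiv_sums q)
  then have "(\<lambda>j. of_nat (Suc j) * q ^ Suc j / (1 - q ^ Suc j)) sums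
      (- q * (deriv euler q / euler q))"
    by (simp add: mult_ac)
  then have "lambert q = - q * (deriv euler q / euler q)"
    using lambert_sums[OF q(2)] sums_unique2 by blast
  then have "deriv euler q = euler q * - lambert q / q"
    using euler_nonzero[OF q(2)] q(1) by simp
  moreover have "(euler has_field_derivative deriv euler q) (at q)"
    using euler_field_differentiable[OF q(2)] DERIV_deriv_iff_field_differentiable by blast
  ultimately show ?thesis by (simp add: has_qderiv_def)
qed

lemma euler_power_nonzero:
  assumes "norm q < 1" "k > 0"
  shows "euler (q ^ k) \<noteq> 0"
  by (intro euler_nonzero norm_power_less_one assms)

lemma holomorphic_on_compose_power:
  assumes "f holomorphic_on ball 0 1" "k > 0"
  shows "(\<lambda>q. f (q ^ k)) holomorphic_on ball 0 1"
proof -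
  have "(\<lambda>q. q ^ k) holomorphic_on ball (0 :: complex) 1" by (intro holomorphic_intros)
  from holomorphic_on_compose_gen[OF this assms(1)] show ?thesis
    using assms(2) by (simp add: o_def image_subset_iff Pi_def norm_power_less_one)
qed

lemma eta_quot_holomorphic:
  assumes "\<forall>(k, r)\<in>set rs. k > 0"
  shows "eta_quot rs holomorphic_on ball 0 1"
  using assms
proof (induction rs)
  case Nil
  then show ?case by (simp add: eta_quot_def[abs_def])
next
  case (Cons kr rs)
  obtain k r where kr: "kr = (k, r)" "k > 0" using Cons.prems by (cases kr) auto
  have "(\<lambda>q. euler (q ^ k) powi r * eta_quot rs q) holomorphic_on ball 0 1"
    using Cons kr(2) euler_power_nonzero
    by (intro holomorphic_intros holomorphic_on_compose_power euler_holomorphic) auto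
  then show ?case by (simp add: eta_quot_def[abs_def] kr(1))
qed

lemma eta_quot_nonzero:
  assumes "norm q < 1" "\<forall>(k, r)\<in>set rs. k > 0"
  shows "eta_quot rs q \<noteq> 0"
  using assms euler_power_nonzero[OF assms(1)]
  by (induction rs) (auto simp: eta_quot_def)

lemma eta_quot_0: "\<forall>(k, r)\<in>set rs. k > 0 \<Longrightarrow> eta_quot rs 0 = 1"
  by (induction rs) (auto simp: eta_quot_def euler_def qpoch_def power_0_left)

lemma has_qderiv_eta_quot:
  assumes q: "q \<noteq> 0" "norm q < 1" and "\<forall>(k, r)\<in>set rs. k > 0"
  shows "has_qderiv (eta_quot rs)
    (eta_quot rs q * - (\<Sum>(k, r)\<leftarrow>rs. of_int r * of_nat k * lambert (q ^ k))) q"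
  using assms(3)
proof (induction rs)
  case Nil
  then show ?case by (simp add: eta_quot_def[abs_def] has_qderiv_def)
next
  case (Cons kr rs)
  obtain k r where kr: "kr = (k, r)" "k > 0" using Cons.prems by (cases kr) auto
  have "has_qderiv (\<lambda>q. euler (q ^ k)) (euler (q ^ k) * - (of_nat k * lambert (q ^ k))) q"
    using has_qderiv_compose_power[OF has_qderiv_euler[OF _ norm_power_less_one[OF q(2) kr(2)]]
      kr(2) q(1)] q(1)
    by (simp add: mult.left_commute)
  from has_qderiv_mult[OF has_qlogderiv_power_int[OF this] Cons.IH]
  show ?case
    using Cons.prems kr euler_power_nonzero[OF q(2) kr(2)]
    by (simp add: eta_quot_def[abs_def] algebra_simps)
qed

section \<open>The eta quotients of weight 1\<close>

lemma
  assumes "norm q < 1"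
  shows wt1_zero_nonzero: "wt1_zero q \<noteq> 0"
    and wt1_infty_nonzero: "q \<noteq> 0 \<Longrightarrow> wt1_infty q \<noteq> 0"
  using assms by (simp_all add: wt1_zero_def wt1_infty_def eta_quot_nonzero)

lemma wt1_holomorphic:
  "wt1_zero holomorphic_on ball 0 1" "wt1_half holomorphic_on ball 0 1"
  "wt1_infty holomorphic_on ball 0 1"
  unfolding wt1_zero_def wt1_half_def wt1_infty_def[abs_def]
  by (intro holomorphic_intros eta_quot_holomorphic; simp)+

lemma wt1_0: "wt1_zero 0 = 1" "wt1_half 0 = 1" "wt1_third 0 = 1" "wt1_infty 0 = 0"
  by (simp_all add: wt1_zero_def wt1_half_def wt1_third_def wt1_infty_def eta_quot_0)

definition dlog_zero :: "complex \<Rightarrow> complex" where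
  "dlog_zero q = - 6 * lambert q + 6 * lambert (q ^ 2) + 6 * lambert (q ^ 3) - 6 * lambert (q ^ 6)"

definition dlog_half :: "complex \<Rightarrow> complex" where
  "dlog_half q = 3 * lambert q - 12 * lambert (q ^ 2) - 3 * lambert (q ^ 3) + 12 * lambert (q ^ 6)"

definition dlog_third :: "complex \<Rightarrow> complex" where
  "dlog_third q = 2 * lambert q - 2 * lambert (q ^ 2) - 18 * lambert (q ^ 3) + 18 * lambert (q ^ 6)"

definition dlog_infty :: "complex \<Rightarrow> complex" where
  "dlog_infty q = 1 - lambert q + 4 * lambert (q ^ 2) + 9 * lambert (q ^ 3) - 36 * lambert (q ^ 6)"

lemma
  assumes q: "q \<noteq> 0" "norm q < 1"
  shows has_qderiv_wt1_zero: "has_qderiv wt1_zero (wt1_zero q * dlog_zero q) q"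
    and has_qderiv_wt1_half: "has_qderiv wt1_half (wt1_half q * dlog_half q) q"
    and has_qderiv_wt1_third: "has_qderiv wt1_third (wt1_third q * dlog_third q) q"
    and has_qderiv_wt1_infty: "has_qderiv wt1_infty (wt1_infty q * dlog_infty q) q"
proof -
  note eta_quot = has_qderiv_eta_quot[OF q]
  show "has_qderiv wt1_zero (wt1_zero q * dlog_zero q) q"
    unfolding wt1_zero_def
    by (rule has_qderiv_eq_rhs[OF eta_quot])
      (simp_all add: dlog_zero_def algebra_simps)
  show "has_qderiv wt1_half (wt1_half q * dlog_half q) q"
    unfolding wt1_half_def
    by (rule has_qderiv_eq_rhs[OF eta_quot])
      (simp_all add: dlog_half_def algebra_simps)
  show "has_qderiv wt1_third (wt1_third q * dlog_third q) q"
    unfolding wt1_third_def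
    by (rule has_qderiv_eq_rhs[OF eta_quot])
      (simp_all add: dlog_third_def algebra_simps)
  show "has_qderiv wt1_infty (wt1_infty q * dlog_infty q) q"
    unfolding wt1_infty_def[abs_def]
    by (rule has_qderiv_eq_rhs[OF has_qderiv_mult[OF has_qderiv_ident[OF q(1)] eta_quot]])
      (simp_all add: dlog_infty_def algebra_simps)
qed

lemma wt1_third_eq:
  assumes "norm q < 1"
  shows "wt1_third q = wt1_half q - wt1_infty q"
proof (cases "q = 0")
  case False
  note q = False assms
  have "wt1_infty q * wt1_third q = wt1_infty q * (wt1_half q - wt1_infty q)"
    using wt1_third_infty[OF q] wt1_half_infty[OF q] wt1_infty_square[OF q] by algebra
  then show ?thesis using wt1_infty_nonzero[OF assms False] by simp
qed (simp add: wt1_0)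

lemma
  assumes q: "q \<noteq> 0" "norm q < 1"
  shows dlog_half_minus_third:
      "dlog_half q - dlog_third q = wt1_infty q * (wt1_half q - 9 * wt1_infty q)"
    and dlog_half_minus_zero: "dlog_half q - dlog_zero q = 9 * (wt1_third q * wt1_infty q)"
proof -
  note wp = wp_q1_q6[OF q] wp_q2_q6[OF q] wp_q3_q6[OF q]
  have "wt1_infty q * (wt1_half q - 9 * wt1_infty q) =
      wt1_half q * wt1_infty q - 9 * wt1_infty q ^ 2"
    by (simp add: algebra_simps power2_eq_square)
  also have "\<dots> = dlog_half q - dlog_third q"
    by (simp add: wt1_half_infty[OF q] wt1_infty_square[OF q] wp dlog_half_def dlog_third_def)
  finally show "dlog_half q - dlog_third q = wt1_infty q * (wt1_half q - 9 * wt1_infty q)" ..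
  show "dlog_half q - dlog_zero q = 9 * (wt1_third q * wt1_infty q)"
    by (simp add: wt1_third_infty[OF q] wp dlog_half_def dlog_zero_def)
qed

lemma dlog_infty_minus_third:
  assumes q: "q \<noteq> 0" "norm q < 1"
  shows "dlog_infty q - dlog_third q = wt1_half q * (wt1_half q - 9 * wt1_infty q)"
proof -
  have "has_qderiv wt1_third (wt1_half q * dlog_half q - wt1_infty q * dlog_infty q) q"
    by (rule has_qderiv_transform[OF has_qderiv_diff[OF has_qderiv_wt1_half[OF q]
          has_qderiv_wt1_infty[OF q]], of "ball 0 1"])
      (use q wt1_third_eq in auto)
  then have "wt1_third q * dlog_third q = wt1_half q * dlog_half q - wt1_infty q * dlog_infty q"
    using has_qderiv_unique[OF has_qderiv_wt1_third[OF q]] q(1) by blast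
  then have "wt1_infty q * (dlog_infty q - dlog_third q) =
      wt1_half q * (dlog_half q - dlog_third q)"
    by (simp add: wt1_third_eq[OF q(2)] algebra_simps)
  also have "\<dots> = wt1_infty q * (wt1_half q * (wt1_half q - 9 * wt1_infty q))"
    by (simp add: dlog_half_minus_third[OF q])
  finally show ?thesis using wt1_infty_nonzero[OF q(2,1)] by simp
qed

lemma wt1_zero_eq:
  assumes "norm q < 1"
  shows "wt1_zero q = wt1_half q - 9 * wt1_infty q"
proof -
  have "wt1_half q - 9 * wt1_infty q = wt1_zero q"
  proof (rule eq_if_qlogderiv_eq[where R = 1 and L = dlog_zero and q = q])
    show "(\<lambda>q. wt1_half q - 9 * wt1_infty q) holomorphic_on ball 0 1"
      "wt1_zero holomorphic_on ball 0 1"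
      by (intro holomorphic_intros wt1_holomorphic)+
  next
    fix w :: complex assume "w \<in> ball 0 1 - {0}"
    then have w: "w \<noteq> 0" "norm w < 1" by auto
    show "has_qderiv wt1_zero (wt1_zero w * dlog_zero w) w"
      by (rule has_qderiv_wt1_zero[OF w])
    have "wt1_half w * dlog_half w - 9 * (wt1_infty w * dlog_infty w) =
        (wt1_half w - 9 * wt1_infty w) * dlog_zero w"
      using dlog_half_minus_third[OF w] dlog_infty_minus_third[OF w] dlog_half_minus_zero[OF w]
        wt1_third_eq[OF w(2)] by algebra
    then show "has_qderiv (\<lambda>q. wt1_half q - 9 * wt1_infty q)
        ((wt1_half w - 9 * wt1_infty w) * dlog_zero w) w"
      using has_qderiv_diff[OF has_qderiv_wt1_half[OF w]
          has_qderiv_cmult[OF has_qderiv_wt1_infty[OF w]]]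
      by metis
  qed (use assms wt1_zero_nonzero in \<open>auto simp: wt1_0\<close>)
  then show ?thesis ..
qed

section \<open>The differential equation\<close>

definition eis6 :: "complex \<Rightarrow> complex" where
  "eis6 q = wt1_half q ^ 2 - 9 * wt1_infty q ^ 2"

definition root6 :: "complex \<Rightarrow> complex" where
  "root6 q = (wt1_half q ^ 2 - 2 * wt1_half q * wt1_infty q + 9 * wt1_infty q ^ 2) *
     (wt1_half q ^ 2 - 18 * wt1_half q * wt1_infty q + 9 * wt1_infty q ^ 2)"

definition dlog_prod :: "complex \<Rightarrow> complex" where
  "dlog_prod q = dlog_zero q + dlog_half q + dlog_third q + dlog_infty q"

lemma eis6_eq_ramanujan_P:
  assumes q: "q \<noteq> 0" "norm q < 1"
  shows "eis6 q = (6 * ramanujan_P (q ^ 6) - 3 * ramanujan_P (q ^ 3) + 2 * ramanujan_P (q ^ 2)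
    - ramanujan_P q) / 4"
proof -
  have "eis6 q = (dlog_half q - dlog_zero q) + (dlog_infty q - dlog_third q)"
    unfolding dlog_half_minus_zero[OF q] dlog_infty_minus_third[OF q] wt1_third_eq[OF q(2)] eis6_def
    by (simp add: algebra_simps power2_eq_square)
  also have "\<dots> = 1 + 6 * lambert q - 12 * lambert (q ^ 2) + 18 * lambert (q ^ 3)
      - 36 * lambert (q ^ 6)"
    by (simp add: dlog_zero_def dlog_half_def dlog_third_def dlog_infty_def)
  finally show ?thesis
    using q by (simp add: ramanujan_P_eq_lambert norm_power_less_one)
qed

lemma has_qderiv_eis6:
  assumes q: "q \<noteq> 0" "norm q < 1"
  shows "has_qderiv eis6 ((dlog_prod q * eis6 q - root6 q) / 2) q"
proof -
  have "has_qderiv eis6 (2 * wt1_half q ^ 2 * dlog_half q - 18 * wt1_infty q ^ 2 * dlog_infty q) q"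
    unfolding eis6_def[abs_def] power2_eq_square
    by (rule has_qderiv_eq_rhs[OF has_qderiv_diff[OF
          has_qderiv_mult[OF has_qderiv_wt1_half[OF q] has_qderiv_wt1_half[OF q]]
          has_qderiv_cmult[OF has_qderiv_mult[OF has_qderiv_wt1_infty[OF q]
            has_qderiv_wt1_infty[OF q]]]]])
      (simp add: algebra_simps)
  moreover have "2 * (2 * wt1_half q ^ 2 * dlog_half q - 18 * wt1_infty q ^ 2 * dlog_infty q) =
      dlog_prod q * eis6 q - root6 q"
    using dlog_half_minus_third[OF q] dlog_infty_minus_third[OF q] dlog_half_minus_zero[OF q]
      wt1_third_eq[OF q(2)]
    unfolding dlog_prod_def eis6_def root6_def by algebra
  ultimately show ?thesis by (metis nonzero_mult_div_cancel_left zero_neq_numeral)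
qed

lemma
  shows eis6_holomorphic: "eis6 holomorphic_on ball 0 1"
    and root6_holomorphic: "root6 holomorphic_on ball 0 1"
  unfolding eis6_def[abs_def] root6_def[abs_def]
  by (intro holomorphic_intros wt1_holomorphic)+

definition eta_prod_nome :: "complex \<Rightarrow> complex" where
  "eta_prod_nome q = q * eta_quot [(1, 1), (2, 1), (3, 1), (6, 1)] (q ^ 2)"

definition z_nome :: "complex \<Rightarrow> complex" where
  "z_nome q = eis6 (q ^ 2) + 2 * eta_prod_nome q"

definition x_nome :: "complex \<Rightarrow> complex" where
  "x_nome q = eta_prod_nome q / z_nome q"

lemma eta_prod_eq: "eta_prod \<tau> = eta_prod_nome (nome \<tau>)"
proof -
  have nome: "nome (of_nat k * \<tau>) = nome \<tau> ^ k" for k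
    unfolding nome_def by (simp flip: exp_of_nat_mult add: mult_ac)
  have eta: "dedekind_eta (of_nat k * \<tau>) =
      exp (2 * of_real pi * \<i> * (of_nat k * \<tau>) / 24) * euler (nome \<tau> ^ k)" for k
    by (simp add: dedekind_eta_def nome euler_def qpoch_def)
  have "exp (2 * of_real pi * \<i> * (2 * \<tau>) / 24) * exp (2 * of_real pi * \<i> * (4 * \<tau>) / 24) *
      exp (2 * of_real pi * \<i> * (6 * \<tau>) / 24) * exp (2 * of_real pi * \<i> * (12 * \<tau>) / 24) = nome \<tau>"
    unfolding nome_def exp_add[symmetric] by (rule arg_cong[where f = exp]) (simp add: field_simps)
  then show ?thesis
    using eta[of 2] eta[of 4] eta[of 6] eta[of 12]
    by (simp add: eta_prod_def eta_prod_nome_def eta_quot_def mult_ac flip: power_mult)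
qed

lemma z_fun_eq:
  assumes "norm (nome \<tau>) < 1"
  shows "z_fun \<tau> = z_nome (nome \<tau>)"
proof -
  have "nome \<tau> \<noteq> 0" by (simp add: nome_def)
  then show ?thesis
    using assms by (simp add: z_fun_def Let_def z_nome_def eta_prod_eq eis6_eq_ramanujan_P
        norm_power_less_one flip: power_mult)
qed

lemma eta_prod_nome_holomorphic: "eta_prod_nome holomorphic_on ball 0 1"
  unfolding eta_prod_nome_def[abs_def]
  by (intro holomorphic_intros holomorphic_on_compose_power eta_quot_holomorphic) auto

lemma z_nome_holomorphic: "z_nome holomorphic_on ball 0 1"
  unfolding z_nome_def[abs_def]
  by (intro holomorphic_intros holomorphic_on_compose_power eis6_holomorphic
      eta_prod_nome_holomorphic) simp

lemma has_qderiv_eta_prod_nome: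
  assumes q: "q \<noteq> 0" "norm q < 1"
  shows "has_qderiv eta_prod_nome (eta_prod_nome q * dlog_prod (q ^ 2)) q"
  unfolding eta_prod_nome_def[abs_def]
  by (rule has_qderiv_eq_rhs[OF has_qderiv_mult[OF has_qderiv_ident[OF q(1)]
        has_qderiv_compose_power[OF has_qderiv_eta_quot]]])
    (use q in \<open>simp_all add: norm_power_less_one dlog_prod_def dlog_zero_def dlog_half_def
      dlog_third_def dlog_infty_def algebra_simps\<close>)

lemma has_qderiv_z_nome:
  assumes q: "q \<noteq> 0" "norm q < 1"
  shows "has_qderiv z_nome (dlog_prod (q ^ 2) * z_nome q - root6 (q ^ 2)) q"
proof -
  have "q ^ 2 \<noteq> 0" "norm (q ^ 2) < 1"
    using q norm_power_less_one[OF q(2), of 2] by simp_all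
  then have "has_qderiv (\<lambda>q. eis6 (q ^ 2))
      (of_nat 2 * ((dlog_prod (q ^ 2) * eis6 (q ^ 2) - root6 (q ^ 2)) / 2)) q"
    by (intro has_qderiv_compose_power has_qderiv_eis6 q(1)) simp_all
  from has_qderiv_add[OF this has_qderiv_cmult[OF has_qderiv_eta_prod_nome[OF q]]]
  show ?thesis
    unfolding z_nome_def[abs_def]
    by (rule has_qderiv_eq_rhs) (simp add: field_simps)
qed

lemma x_nome_deriv:
  assumes q: "q \<noteq> 0" "norm q < 1" and z: "z_nome q \<noteq> 0"
  shows "q * deriv x_nome q = z_nome q * x_nome q * (root6 (q ^ 2) / z_nome q ^ 2)"
proof -
  have "has_qderiv x_nome (eta_prod_nome q * root6 (q ^ 2) / z_nome q ^ 2) q"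
    unfolding x_nome_def[abs_def]
    by (rule has_qderiv_eq_rhs[OF has_qderiv_divide[OF has_qderiv_eta_prod_nome[OF q]
          has_qderiv_z_nome[OF q] z]])
      (simp add: algebra_simps)
  then show ?thesis using q(1) z by (simp add: has_qderiv_def DERIV_imp_deriv x_nome_def)
qed

lemma eta_prod_nome_square:
  assumes "norm q < 1"
  shows "eta_prod_nome q ^ 2 =
    wt1_zero (q ^ 2) * wt1_half (q ^ 2) * wt1_third (q ^ 2) * wt1_infty (q ^ 2)"
proof -
  have "euler ((q ^ 2) ^ k) \<noteq> 0" if "k > 0" for k
    using assms that by (intro euler_power_nonzero norm_power_less_one) auto
  from this[of 1] this[of 2] this[of 3] this[of 6] show ?thesis
    by (simp add: eta_prod_nome_def wt1_zero_def wt1_half_def wt1_third_def wt1_infty_def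
        eta_quot_def power_int_minus divide_simps) algebra
qed

lemma root6_square:
  assumes q: "norm q < 1" and z: "z_nome q \<noteq> 0"
  shows "(root6 (q ^ 2) / z_nome q ^ 2) ^ 2 =
    (1 + 4 * x_nome q) * (1 - 4 * x_nome q) * (1 - 8 * x_nome q)"
proof -
  define f E where "f = eta_prod_nome q" and "E = eis6 (q ^ 2)"
  have z_eq: "z_nome q = E + 2 * f" by (simp add: z_nome_def f_def E_def)
  have q2: "norm (q ^ 2) < 1" by (rule norm_power_less_one[OF q]) simp
  define b d where "b = wt1_half (q ^ 2)" and "d = wt1_infty (q ^ 2)"
  have E: "E = b ^ 2 - 9 * d ^ 2" by (simp add: E_def eis6_def b_def d_def)
  have f: "f ^ 2 = (b - 9 * d) * b * (b - d) * d"
    by (simp add: f_def b_def d_def eta_prod_nome_square[OF q] wt1_zero_eq[OF q2]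
        wt1_third_eq[OF q2])
  have "E ^ 2 - 4 * f ^ 2 = (b ^ 2 - 2 * b * d + 9 * d ^ 2) ^ 2"
    "E ^ 2 - 36 * f ^ 2 = (b ^ 2 - 18 * b * d + 9 * d ^ 2) ^ 2"
    unfolding E f by algebra+
  then have "root6 (q ^ 2) ^ 2 = (E ^ 2 - 4 * f ^ 2) * (E ^ 2 - 36 * f ^ 2)"
    by (simp add: root6_def b_def d_def power_mult_distrib)
  also have "\<dots> = z_nome q * ((z_nome q + 4 * f) * (z_nome q - 4 * f) * (z_nome q - 8 * f))"
    unfolding z_eq by algebra
  finally have "(root6 (q ^ 2) / z_nome q ^ 2) ^ 2 =
      z_nome q * ((z_nome q + 4 * f) * (z_nome q - 4 * f) * (z_nome q - 8 * f)) / z_nome q ^ 4"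
    by (simp add: power_divide)
  also have "\<dots> = (1 + 4 * x_nome q) * (1 - 4 * x_nome q) * (1 - 8 * x_nome q)"
    using z by (simp add: x_nome_def f_def divide_simps) algebra
  finally show ?thesis .
qed

lemma
  shows root6_0: "root6 0 = 1" and z_nome_0: "z_nome 0 = 1" and x_nome_0: "x_nome 0 = 0"
  by (simp_all add: root6_def z_nome_def x_nome_def eis6_def eta_prod_nome_def wt1_0)

lemma csqrt_eq_root6_near_0:
  obtains r where "r > 0" "ball 0 r \<subseteq> (ball 0 1 :: complex set)"
    "\<And>q. q \<in> ball 0 r \<Longrightarrow> z_nome q \<noteq> 0"
    "\<And>q. q \<in> ball 0 r \<Longrightarrow>
      csqrt ((1 + 4 * x_nome q) * (1 - 4 * x_nome q) * (1 - 8 * x_nome q)) =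
        root6 (q ^ 2) / z_nome q ^ 2"
proof -
  define g where "g q = root6 (q ^ 2) / z_nome q ^ 2" for q
  have "isCont z_nome 0" "isCont (\<lambda>q. root6 (q ^ 2)) 0"
    using z_nome_holomorphic holomorphic_on_compose_power[OF root6_holomorphic, of 2]
    by (auto dest!: holomorphic_on_imp_continuous_on simp: continuous_on_eq_continuous_at)
  then have "isCont g 0" "isCont z_nome 0"
    unfolding g_def by (auto intro!: continuous_intros simp: z_nome_0)
  then have "((\<lambda>q. Re (g q)) \<longlongrightarrow> 1) (nhds 0)" "(z_nome \<longlongrightarrow> 1) (nhds 0)"
    using tendsto_Re[of g 1 "nhds 0"]
    by (simp_all add: isCont_def tendsto_nhds_iff g_def z_nome_0 root6_0)
  then have "eventually (\<lambda>q. Re (g q) > 0 \<and> z_nome q \<noteq> 0 \<and> q \<in> ball 0 1) (nhds 0)"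
    by (intro eventually_conj order_tendstoD(1) tendsto_imp_eventually_ne eventually_nhds_ball) auto
  then obtain r where r: "r > 0" "\<And>q. q \<in> ball 0 r \<Longrightarrow> Re (g q) > 0 \<and> z_nome q \<noteq> 0 \<and> q \<in> ball 0 1"
    unfolding eventually_nhds_metric by (auto simp: dist_commute)
  show ?thesis
  proof
    show "r > 0" "ball 0 r \<subseteq> (ball 0 1 :: complex set)" using r by auto
    fix q :: complex assume q: "q \<in> ball 0 r"
    show z: "z_nome q \<noteq> 0" using r(2)[OF q] by simp
    show "csqrt ((1 + 4 * x_nome q) * (1 - 4 * x_nome q) * (1 - 8 * x_nome q)) =
        root6 (q ^ 2) / z_nome q ^ 2"
      using root6_square[OF _ z] r(2)[OF q] by (intro csqrt_unique) (auto simp: g_def)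
  qed
qed

theorem theorem3p2:
  shows "\<exists>r>0. \<exists>x z :: complex \<Rightarrow> complex.
    x holomorphic_on ball 0 r \<and> z holomorphic_on ball 0 r \<and> x 0 = 0 \<and>
    (\<forall>\<tau>. Im \<tau> > 0 \<and> nome \<tau> \<in> ball 0 r \<longrightarrow>
       z_fun \<tau> \<noteq> 0 \<and> z (nome \<tau>) = z_fun \<tau> \<and> x (nome \<tau>) = x_fun \<tau>) \<and>
    (\<forall>q\<in>ball 0 r. q * deriv x q =
       z q * x q * csqrt ((1 + 4 * x q) * (1 - 4 * x q) * (1 - 8 * x q)))"
proof -
  obtain r where r: "r > 0" "ball 0 r \<subseteq> (ball 0 1 :: complex set)"
    and z: "\<And>q. q \<in> ball 0 r \<Longrightarrow> z_nome q \<noteq> 0"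
    and root: "\<And>q. q \<in> ball 0 r \<Longrightarrow>
      csqrt ((1 + 4 * x_nome q) * (1 - 4 * x_nome q) * (1 - 8 * x_nome q)) =
        root6 (q ^ 2) / z_nome q ^ 2"
    using csqrt_eq_root6_near_0 by metis
  have holo: "z_nome holomorphic_on ball 0 r" "x_nome holomorphic_on ball 0 r"
    unfolding x_nome_def[abs_def] using z
    by (intro holomorphic_intros holomorphic_on_subset[OF z_nome_holomorphic r(2)]
        holomorphic_on_subset[OF eta_prod_nome_holomorphic r(2)]; simp)+
  have at_nome: "z_nome (nome \<tau>) = z_fun \<tau>" "x_nome (nome \<tau>) = x_fun \<tau>" if "nome \<tau> \<in> ball 0 r" for \<tau>
    using that r(2) by (auto simp: z_fun_eq x_fun_def x_nome_def eta_prod_eq)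
  have ode: "q * deriv x_nome q = z_nome q * x_nome q *
      csqrt ((1 + 4 * x_nome q) * (1 - 4 * x_nome q) * (1 - 8 * x_nome q))"
    if q: "q \<in> ball 0 r" for q
    using x_nome_deriv[OF _ _ z[OF q]] r(2) q unfolding root[OF q]
    by (cases "q = 0") (auto simp: x_nome_0)
  have z_fun_nonzero: "z_fun \<tau> \<noteq> 0" if "nome \<tau> \<in> ball 0 r" for \<tau>
    using z at_nome(1) that by metis
  show ?thesis
    by (rule exI[of _ r], rule conjI[OF r(1)], rule exI[of _ x_nome], rule exI[of _ z_nome])
      (use holo at_nome ode z_fun_nonzero x_nome_0 in blast)
qed

end
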